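(* Let $p_{abe|XYE}$ be a tripartite non-signalling box with parties $A,B,E$. If the reduced probability distribution $p_{ab|XY}=\sum_e p_{abe|XYE}$ is a vertex of the bipartite no-signalling polytope, then the composite system $AB$ is local versus $E$.
   Context: A tripartite non-signalling box is a family of reals $p_{abe|XYE}$, indexed by inputs $X,Y,E$ and outputs $a,b,e$ of parties $A,B,E$ respectively (all ranging over finite sets), with $p_{abe|XYE}\ge 0$, $\sum_{a,b,e}p_{abe|XYE}=1$ for all $X,Y,E$, and such that no single party can signal to the other two combined: $\sum_a p_{abe|XYE}$ does not depend on $X$, $\sum_b p_{abe|XYE}$ does not depend on $Y$, and $\sum_e p_{abe|XYE}$ does not depend on $E$ (for all values of the remaining indices). In particular the reduced distribution $\sum_e p_{abe|XYE}$ is well defined independently of $E$. The bipartite no-signalling polytope, for the given input and output sets of $A$ and $B$, is the set of all families $p_{ab|XY}\ge 0$ with $\sum_{a,b}p_{ab|XY}=1$ for all $X,Y$, with $\sum_b p_{ab|XY}$ independent of $Y$ and $\sum_a p_{ab|XY}$ independent of $X$. Its vertices are its extreme points. "$AB$ is local versus $E$" means that $p_{abe|XYE}=\sum_\lambda p_\lambda\,p_{ab|XY}(\lambda)\,p_{e|E}(\lambda)$ for some probability distribution $(p_\lambda)$ and conditional probability distributions $p_{ab|XY}(\lambda)$, $p_{e|E}(\lambda)$. *)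

theory Defs
  imports "HOL-Analysis.Analysis"
begin

text \<open>
  Inputs and outputs range over finite types. Boxes carry the outputs first and then the inputs:
  \<open>p a b e X Y E\<close> stands for $p_{abe|XYE}$.
\<close>

definition tripartite_ns_box ::
  "('a::finite \<Rightarrow> 'b::finite \<Rightarrow> 'e::finite \<Rightarrow> 'x::finite \<Rightarrow> 'y::finite \<Rightarrow> 'z::finite \<Rightarrow> real) \<Rightarrow> bool"
where
  "tripartite_ns_box p \<longleftrightarrow>
     (\<forall>a b e X Y E. 0 \<le> p a b e X Y E) \<and>
     (\<forall>X Y E. (\<Sum>a\<in>UNIV. \<Sum>b\<in>UNIV. \<Sum>e\<in>UNIV. p a b e X Y E) = 1) \<and>
     (\<forall>b e X X' Y E. (\<Sum>a\<in>UNIV. p a b e X Y E) = (\<Sum>a\<in>UNIV. p a b e X' Y E)) \<and>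
     (\<forall>a e X Y Y' E. (\<Sum>b\<in>UNIV. p a b e X Y E) = (\<Sum>b\<in>UNIV. p a b e X Y' E)) \<and>
     (\<forall>a b X Y E E'. (\<Sum>e\<in>UNIV. p a b e X Y E) = (\<Sum>e\<in>UNIV. p a b e X Y E'))"

text \<open>
  Bipartite families are vectors indexed by \<open>(a, b, X, Y)\<close>, so that the library's
  \<^const>\<open>extreme_point_of\<close> applies to sets of them.
\<close>

definition bipartite_ns_polytope ::
  "(real ^ ('a::finite \<times> 'b::finite \<times> 'x::finite \<times> 'y::finite)) set"
where
  "bipartite_ns_polytope =
     {q. (\<forall>a b X Y. 0 \<le> q $ (a, b, X, Y)) \<and>
         (\<forall>X Y. (\<Sum>a\<in>UNIV. \<Sum>b\<in>UNIV. q $ (a, b, X, Y)) = 1) \<and>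
         (\<forall>a X Y Y'. (\<Sum>b\<in>UNIV. q $ (a, b, X, Y)) = (\<Sum>b\<in>UNIV. q $ (a, b, X, Y'))) \<and>
         (\<forall>b X X' Y. (\<Sum>a\<in>UNIV. q $ (a, b, X, Y)) = (\<Sum>a\<in>UNIV. q $ (a, b, X', Y)))}"

text \<open>The input \<open>E\<close> is immaterial for non-signalling boxes, see \<open>reduced_AB_indep\<close>.\<close>

definition reduced_AB ::
  "('a::finite \<Rightarrow> 'b::finite \<Rightarrow> 'e::finite \<Rightarrow> 'x::finite \<Rightarrow> 'y::finite \<Rightarrow> 'z::finite \<Rightarrow> real) \<Rightarrow> 'z \<Rightarrow>
     real ^ ('a \<times> 'b \<times> 'x \<times> 'y)"
where
  "reduced_AB p E = vec_lambda (\<lambda>(a, b, X, Y). \<Sum>e\<in>UNIV. p a b e X Y E)"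

lemma reduced_AB_indep:
  assumes "tripartite_ns_box p"
  shows "reduced_AB p E = reduced_AB p E'"
proof -
  have "(\<Sum>e\<in>UNIV. p a b e X Y E) = (\<Sum>e\<in>UNIV. p a b e X Y E')" for a b X Y
    using assms unfolding tripartite_ns_box_def by blast
  then show ?thesis
    by (simp add: reduced_AB_def)
qed

definition cond_prob_dist :: "('o::finite \<Rightarrow> 'i \<Rightarrow> real) \<Rightarrow> bool" where
  "cond_prob_dist f \<longleftrightarrow> (\<forall>i. (\<forall>k. 0 \<le> f k i) \<and> (\<Sum>k\<in>UNIV. f k i) = 1)"

text \<open>
  The hidden variable takes finitely many values; taking them in \<^typ>\<open>nat\<close> is no restriction.
\<close>

definition AB_local_versus_E ::
  "('a::finite \<Rightarrow> 'b::finite \<Rightarrow> 'e::finite \<Rightarrow> 'x::finite \<Rightarrow> 'y::finite \<Rightarrow> 'z::finite \<Rightarrow> real) \<Rightarrow> bool"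
where
  "AB_local_versus_E p \<longleftrightarrow>
     (\<exists>(\<Lambda> :: nat set) (w :: nat \<Rightarrow> real)
        (r :: nat \<Rightarrow> 'a \<times> 'b \<Rightarrow> 'x \<times> 'y \<Rightarrow> real) (s :: nat \<Rightarrow> 'e \<Rightarrow> 'z \<Rightarrow> real).
        finite \<Lambda> \<and> (\<forall>l\<in>\<Lambda>. 0 \<le> w l) \<and> (\<Sum>l\<in>\<Lambda>. w l) = 1 \<and>
        (\<forall>l\<in>\<Lambda>. cond_prob_dist (r l)) \<and> (\<forall>l\<in>\<Lambda>. cond_prob_dist (s l)) \<and>
        (\<forall>a b e X Y E. p a b e X Y E = (\<Sum>l\<in>\<Lambda>. w l * r l (a, b) (X, Y) * s l e E)))"

end

theory Submission
  imports Defs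
begin

text \<open>
  Let $q$ be the reduced box and, for an outcome $e$ of the input $E$, let $d$ be the unnormalised
  box $p_{abe|XYE}$ of $A$ and $B$, whose total mass $m$ depends on $e$ and $E$ only. Since
  $0 \le d \le q$ and $m \le 1$, both $q + (d - m q)$ and $q - (d - m q)$ are non-signalling boxes,
  and $q$ is their midpoint. Hence $d = m q$ if $q$ is a vertex, and one value of the
  hidden variable suffices.
\<close>

text \<open>If \<open>d\<close> were nonzero, \<open>x\<close> would be the midpoint of two distinct
  points of \<open>S\<close>, hence interior to a segment in \<open>S\<close>, which extremality
  forbids.\<close>

lemma extreme_point_symmetric_perturbation:
  fixes x d :: "'a::real_vector"
  assumes "x extreme_point_of S" "x + d \<in> S" "x - d \<in> S"
  shows "d = 0"
proof (rule ccontr)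
  assume "d \<noteq> 0"
  moreover have diff: "(x + d) - (x - d) = 2 *\<^sub>R d"
    by (simp add: scaleR_2)
  ultimately have "(x + d) - (x - d) \<noteq> 0"
    unfolding diff by simp
  then have "x + d \<noteq> x - d"
    by (simp only: right_minus_eq not_False_eq_True)
  then have "midpoint (x + d) (x - d) \<in> open_segment (x + d) (x - d)"
    by (simp only: midpoint_in_open_segment not_False_eq_True)
  moreover have "(x + d) + (x - d) = 2 *\<^sub>R x"
    by (simp add: scaleR_2)
  then have "midpoint (x + d) (x - d) = x"
    by (simp only: midpoint_def scaleR_scaleR) simp
  ultimately show False
    using assms unfolding extreme_point_of_def by metis
qed

lemma tripartite_ns_boxD:
  assumes "tripartite_ns_box p"
  shows tripartite_ns_box_nonneg: "0 \<le> p a b e X Y E"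
    and tripartite_ns_box_sum:
      "(\<Sum>a\<in>UNIV. \<Sum>b\<in>UNIV. \<Sum>e\<in>UNIV. p a b e X Y E) = 1"
    and tripartite_ns_box_ns_A:
      "(\<Sum>a\<in>UNIV. p a b e X Y E) = (\<Sum>a\<in>UNIV. p a b e X' Y E)"
    and tripartite_ns_box_ns_B:
      "(\<Sum>b\<in>UNIV. p a b e X Y E) = (\<Sum>b\<in>UNIV. p a b e X Y' E)"
proof -
  note conj = assms [unfolded tripartite_ns_box_def]
  note tail = conj [THEN conjunct2, THEN conjunct2]
  show "0 \<le> p a b e X Y E"
    by (rule conj [THEN conjunct1, rule_format])
  show "(\<Sum>a\<in>UNIV. \<Sum>b\<in>UNIV. \<Sum>e\<in>UNIV. p a b e X Y E) = 1"
    by (rule conj [THEN conjunct2, THEN conjunct1, rule_format])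
  show "(\<Sum>a\<in>UNIV. p a b e X Y E) = (\<Sum>a\<in>UNIV. p a b e X' Y E)"
    by (rule tail [THEN conjunct1, rule_format])
  show "(\<Sum>b\<in>UNIV. p a b e X Y E) = (\<Sum>b\<in>UNIV. p a b e X Y' E)"
    by (rule tail [THEN conjunct2, THEN conjunct1, rule_format])
qed

lemma bipartite_ns_polytopeD:
  assumes "q \<in> bipartite_ns_polytope"
  shows bipartite_ns_polytope_nonneg: "0 \<le> q $ (a, b, X, Y)"
    and bipartite_ns_polytope_sum: "(\<Sum>a\<in>UNIV. \<Sum>b\<in>UNIV. q $ (a, b, X, Y)) = 1"
    and bipartite_ns_polytope_ns_B:
      "(\<Sum>b\<in>UNIV. q $ (a, b, X, Y)) = (\<Sum>b\<in>UNIV. q $ (a, b, X, Y'))"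
    and bipartite_ns_polytope_ns_A:
      "(\<Sum>a\<in>UNIV. q $ (a, b, X, Y)) = (\<Sum>a\<in>UNIV. q $ (a, b, X', Y))"
proof -
  note conj = assms [unfolded bipartite_ns_polytope_def mem_Collect_eq]
  note tail = conj [THEN conjunct2, THEN conjunct2]
  show "0 \<le> q $ (a, b, X, Y)"
    by (rule conj [THEN conjunct1, rule_format])
  show "(\<Sum>a\<in>UNIV. \<Sum>b\<in>UNIV. q $ (a, b, X, Y)) = 1"
    by (rule conj [THEN conjunct2, THEN conjunct1, rule_format])
  show "(\<Sum>b\<in>UNIV. q $ (a, b, X, Y)) = (\<Sum>b\<in>UNIV. q $ (a, b, X, Y'))"
    by (rule tail [THEN conjunct1, rule_format])
  show "(\<Sum>a\<in>UNIV. q $ (a, b, X, Y)) = (\<Sum>a\<in>UNIV. q $ (a, b, X', Y))"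
    by (rule tail [THEN conjunct2, rule_format])
qed

text \<open>\<open>A\<close> and \<open>B\<close> together cannot signal to \<open>E\<close>: the
  inputs are changed one at a time, each under the inner sum over the output of its own party, with
  the order of summation swapped in between.\<close>

lemma AB_marginal_indep:
  assumes "tripartite_ns_box p"
  shows "(\<Sum>a\<in>UNIV. \<Sum>b\<in>UNIV. p a b e X Y E) = (\<Sum>a\<in>UNIV. \<Sum>b\<in>UNIV. p a b e X' Y' E)"
proof -
  have "(\<Sum>a\<in>UNIV. \<Sum>b\<in>UNIV. p a b e X Y E) = (\<Sum>a\<in>UNIV. \<Sum>b\<in>UNIV. p a b e X Y' E)"
    by (intro sum.cong refl tripartite_ns_box_ns_B [OF assms])
  also have "\<dots> = (\<Sum>b\<in>UNIV. \<Sum>a\<in>UNIV. p a b e X Y' E)"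
    by (rule sum.swap)
  also have "\<dots> = (\<Sum>b\<in>UNIV. \<Sum>a\<in>UNIV. p a b e X' Y' E)"
    by (intro sum.cong refl tripartite_ns_box_ns_A [OF assms])
  also have "\<dots> = (\<Sum>a\<in>UNIV. \<Sum>b\<in>UNIV. p a b e X' Y' E)"
    by (rule sum.swap)
  finally show ?thesis .
qed

text \<open>Moving the sum over \<open>e\<close> to the front turns the normalisation of the box
  into that of the distribution of \<open>E\<close>.\<close>

lemma E_marginal_sum:
  assumes "tripartite_ns_box p"
  shows "(\<Sum>e\<in>UNIV. \<Sum>a\<in>UNIV. \<Sum>b\<in>UNIV. p a b e X Y E) = 1"
proof -
  have "(\<Sum>e\<in>UNIV. \<Sum>a\<in>UNIV. \<Sum>b\<in>UNIV. p a b e X Y E)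
      = (\<Sum>a\<in>UNIV. \<Sum>e\<in>UNIV. \<Sum>b\<in>UNIV. p a b e X Y E)"
    by (rule sum.swap)
  also have "\<dots> = (\<Sum>a\<in>UNIV. \<Sum>b\<in>UNIV. \<Sum>e\<in>UNIV. p a b e X Y E)"
    by (intro sum.cong refl sum.swap)
  also have "\<dots> = 1"
    by (rule tripartite_ns_box_sum [OF assms])
  finally show ?thesis .
qed

text \<open>The premise on \<open>m\<close> is the form in which no-signalling from \<open>A\<close>
  and \<open>B\<close> to \<open>E\<close> enters: one scalar has to rescale the slice for all
  \<open>X\<close> and \<open>Y\<close> at once.\<close>

lemma slice_proportional_if_extreme:
  fixes p :: "'a::finite \<Rightarrow> 'b::finite \<Rightarrow> 'e::finite \<Rightarrow> 'x::finite \<Rightarrow> 'y::finite \<Rightarrow> 'z::finite \<Rightarrow> real"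
  assumes p: "tripartite_ns_box p"
    and ext: "reduced_AB p E extreme_point_of bipartite_ns_polytope"
    and m: "\<And>X Y. (\<Sum>a\<in>UNIV. \<Sum>b\<in>UNIV. p a b e X Y E) = m"
  shows "p a b e X Y E = m * reduced_AB p E $ (a, b, X, Y)"
proof -
  let ?q = "reduced_AB p E"
  define D :: "real ^ ('a \<times> 'b \<times> 'x \<times> 'y)" where
    "D = vec_lambda (\<lambda>(a, b, X, Y). p a b e X Y E)"
  have D [simp]: "D $ (a, b, X, Y) = p a b e X Y E" for a b X Y
    by (simp add: D_def)
  note nonneg = tripartite_ns_box_nonneg [OF p]
  have le: "p a b e X Y E \<le> ?q $ (a, b, X, Y)" for a b X Y
    unfolding reduced_AB_def using nonneg by (auto intro!: member_le_sum)
  have q: "?q \<in> bipartite_ns_polytope"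
    using ext by (simp add: extreme_point_of_def)
  note q0 = bipartite_ns_polytope_nonneg [OF q]
  note q1 = bipartite_ns_polytope_sum [OF q]
  note q2 = bipartite_ns_polytope_ns_B [OF q]
  note q3 = bipartite_ns_polytope_ns_A [OF q]
  note p2 = tripartite_ns_box_ns_B [OF p]
  note p3 = tripartite_ns_box_ns_A [OF p]
  have m0: "0 \<le> m"
    unfolding m [of X Y, symmetric] by (intro sum_nonneg nonneg)
  \<comment> \<open>The slice lies below \<open>?q\<close> entry by entry, and \<open>?q\<close> has
    total mass 1.\<close>
  have m1: "m \<le> 1"
    unfolding m [of X Y, symmetric] q1 [of X Y, symmetric] by (intro sum_mono le)
  \<comment> \<open>The no-signalling constraints are linear and homogeneous, so every combination
    of \<open>?q\<close> and \<open>D\<close> satisfies them. Normalisation becomes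
    \<open>s + t * m = 1\<close>, which leaves only the signs of the entries to check for given
    \<open>s\<close> and \<open>t\<close>.\<close>
  have affine: "s *\<^sub>R ?q + t *\<^sub>R D \<in> bipartite_ns_polytope"
    if "\<And>a b X Y. 0 \<le> s * ?q $ (a, b, X, Y) + t * p a b e X Y E" "s + t * m = 1" for s t
    unfolding bipartite_ns_polytope_def mem_Collect_eq
  proof (intro conjI allI)
    show "(\<Sum>b\<in>UNIV. (s *\<^sub>R ?q + t *\<^sub>R D) $ (a, b, X, Y))
        = (\<Sum>b\<in>UNIV. (s *\<^sub>R ?q + t *\<^sub>R D) $ (a, b, X, Y'))" for a X Y Y'
      using q2 [of a X Y Y'] p2 [of a e X Y E Y'] by (simp add: sum.distrib flip: sum_distrib_left)
    show "(\<Sum>a\<in>UNIV. (s *\<^sub>R ?q + t *\<^sub>R D) $ (a, b, X, Y))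
        = (\<Sum>a\<in>UNIV. (s *\<^sub>R ?q + t *\<^sub>R D) $ (a, b, X', Y))" for b X X' Y
      using q3 [of b X Y X'] p3 [of b e X Y E X'] by (simp add: sum.distrib flip: sum_distrib_left)
  qed (use that in \<open>simp_all add: sum.distrib q1 m flip: sum_distrib_left\<close>)
  \<comment> \<open>This point is \<open>?q + (D - m *\<^sub>R ?q)\<close>; its entries are
    nonnegative because \<open>m \<le> 1\<close>.\<close>
  have "(1 - m) *\<^sub>R ?q + 1 *\<^sub>R D \<in> bipartite_ns_polytope"
    using m1 q0 nonneg by (intro affine) simp_all
  \<comment> \<open>The mirror image \<open>?q - (D - m *\<^sub>R ?q)\<close>: its entries are those
    of \<open>?q - D\<close>, nonnegative by \<open>le\<close>, plus those of
    \<open>m *\<^sub>R ?q\<close>.\<close>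
  moreover have "(1 + m) *\<^sub>R ?q + (- 1) *\<^sub>R D \<in> bipartite_ns_polytope"
  proof (rule affine)
    show "0 \<le> (1 + m) * ?q $ (a, b, X, Y) + - 1 * p a b e X Y E" for a b X Y
      using le [of a b X Y] mult_nonneg_nonneg [OF m0 q0 [of a b X Y]]
      by (simp add: algebra_simps)
  qed simp
  ultimately have "D - m *\<^sub>R ?q = 0"
    by (intro extreme_point_symmetric_perturbation [OF ext]) (simp_all add: algebra_simps)
  then have "D $ (a, b, X, Y) = (m *\<^sub>R ?q) $ (a, b, X, Y)"
    by simp
  then show ?thesis
    by simp
qed

theorem mainTheorem9:
  fixes p :: "'a::finite \<Rightarrow> 'b::finite \<Rightarrow> 'e::finite \<Rightarrow> 'x::finite \<Rightarrow> 'y::finite \<Rightarrow> 'z::finite \<Rightarrow> real"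
    and E :: 'z
  assumes "tripartite_ns_box p"
    and "reduced_AB p E extreme_point_of bipartite_ns_polytope"
  shows "AB_local_versus_E p"
proof -
  let ?q = "reduced_AB p E"
  define r :: "'a \<times> 'b \<Rightarrow> 'x \<times> 'y \<Rightarrow> real" where
    "r = (\<lambda>(a, b) (X, Y). ?q $ (a, b, X, Y))"
  \<comment> \<open>The inputs of \<open>A\<close> and \<open>B\<close> are fixed to
    \<open>undefined\<close>; by \<open>AB_marginal_indep\<close> any other choice gives the same
    value.\<close>
  define s where
    "s e F = (\<Sum>a\<in>UNIV. \<Sum>b\<in>UNIV. p a b e undefined undefined F)" for e F
  have q: "?q \<in> bipartite_ns_polytope"
    using assms(2) by (simp add: extreme_point_of_def)
  have sum_r: "(\<Sum>k\<in>UNIV. r k i) = 1" for i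
  proof -
    have "(\<Sum>k\<in>UNIV. r k i) = (\<Sum>a\<in>UNIV. \<Sum>b\<in>UNIV. r (a, b) i)"
      by (simp add: sum.cartesian_product)
    also have "\<dots> = 1"
      by (cases i) (simp add: r_def bipartite_ns_polytope_sum [OF q])
    finally show ?thesis .
  qed
  have r: "cond_prob_dist r"
    using sum_r bipartite_ns_polytope_nonneg [OF q] by (auto simp: cond_prob_dist_def r_def)
  have s: "cond_prob_dist s"
    unfolding cond_prob_dist_def
  proof (intro allI conjI)
    show "0 \<le> s e F" for e F
      unfolding s_def by (intro sum_nonneg tripartite_ns_box_nonneg [OF assms(1)])
    show "(\<Sum>e\<in>UNIV. s e F) = 1" for F
      unfolding s_def by (rule E_marginal_sum [OF assms(1)])
  qed
  have "p a b e X Y F = r (a, b) (X, Y) * s e F" for a b e X Y F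
  proof -
    \<comment> \<open>Extremality is assumed at the single input \<open>E\<close>, but the slices at
      every input \<open>F\<close> are needed. The reduced box is the same for all of them.\<close>
    have "reduced_AB p F extreme_point_of bipartite_ns_polytope"
      using assms(2) reduced_AB_indep [OF assms(1), of F E] by simp
    then have "p a b e X Y F = s e F * reduced_AB p F $ (a, b, X, Y)"
      unfolding s_def
      by (rule slice_proportional_if_extreme [OF assms(1) _ AB_marginal_indep [OF assms(1)]])
    also have "reduced_AB p F = ?q"
      by (rule reduced_AB_indep [OF assms(1)])
    finally show ?thesis
      by (simp add: r_def)
  qed
  \<comment> \<open>The box is already a product, so the hidden variable takes the single value 0,
    with weight 1.\<close>
  with r s show ?thesis
    unfolding AB_local_versus_E_def
    by (intro exI [of _ "{0}"] exI [of _ "\<lambda>_. 1"] exI [of _ "\<lambda>_. r"] exI [of _ "\<lambda>_. s"]) simp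
qed

end
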